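(* Let $G$ be a commutative group with identity $0$, let $k,n\in\mathbb N$, let $A:G^n\to G^k$ be a group homomorphism, and let $b\in G^k$ with $b\neq 0$. Then the equation $Ax=b$ (with $x\in G^n$) is partition regular over $G$ if and only if it has a constant solution, i.e., there is $y\in G$ with $A(y,y,\dots,y)=b$.
   Context: The equation $Ax=b$ is partition regular over $G$ if for every finite coloring of $G$ (i.e., every partition of $G$ into finitely many classes) there exists $x=(x_1,\dots,x_n)\in G^n$ with $Ax=b$ such that $x_1,\dots,x_n$ all have the same color. *)

theory Defs
  imports "HOL-Algebra.Algebra" "HOL-Library.Disjoint_Sets"
begin

text \<open>
  Groups are written multiplicatively, as in HOL-Algebra: the identity \<open>0\<close> of the informal
  statement is \<open>\<one>\<close>. Tuples are extensional functions on \<open>{..<n}\<close>.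
\<close>

abbreviation power_group :: "('a, 'b) monoid_scheme \<Rightarrow> nat \<Rightarrow> (nat \<Rightarrow> 'a) monoid"
  where "power_group G n \<equiv> product_group {..<n} (\<lambda>_. G)"

definition partition_regular ::
    "('a, 'b) monoid_scheme \<Rightarrow> nat \<Rightarrow> ((nat \<Rightarrow> 'a) \<Rightarrow> (nat \<Rightarrow> 'a)) \<Rightarrow> (nat \<Rightarrow> 'a) \<Rightarrow> bool"
  where "partition_regular G n A b \<longleftrightarrow>
    (\<forall>P. partition_on (carrier G) P \<and> finite P \<longrightarrow>
      (\<exists>x \<in> carrier (power_group G n). A x = b \<and> (\<exists>C\<in>P. \<forall>i<n. x i \<in> C)))"

end

theory Submission
  imports Defs "HOL-Analysis.Topology_Euclidean_Space"
begin

text \<open>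
  If \<open>b\<close> is not in the image \<open>K\<close> of the constant tuples, then, the circle being divisible, some
  character \<open>\<psi>\<close> of \<open>G\<^sup>k\<close> is trivial on \<open>K\<close> but not at \<open>b\<close>. The character \<open>\<psi> \<circ> A\<close> of \<open>G\<^sup>n\<close> is a
  product of characters of the coordinates, so, the circle being compact, \<open>G\<close> has a finite
  colouring for which \<open>\<psi> \<circ> A\<close> varies by less than \<open>\<bar>\<psi> b - 1\<bar>\<close> on the tuples of any one colour. These
  include constant tuples, where \<open>\<psi> \<circ> A\<close> is \<open>1\<close>, so none of them solves \<open>A x = b\<close>.
\<close>

section \<open>Homomorphisms separating a point from a subgroup\<close>

lemma (in normal) int_pow_mem_iff_ord_dvd:
  assumes "x \<in> carrier G"
  shows "x [^] (j::int) \<in> H \<longleftrightarrow> int (group.ord (G Mod H) (H #> x)) dvd j"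
proof -
  interpret Q: group "G Mod H"
    by (rule factorgroup_is_group)
  have "x [^] j \<in> H \<longleftrightarrow> H #> x [^] j = H"
    using coset_join1[OF _ _ subgroup_axioms] coset_join2[OF _ subgroup_axioms] assms by auto
  also have "\<dots> \<longleftrightarrow> (H #> x) [^]\<^bsub>G Mod H\<^esub> j = \<one>\<^bsub>G Mod H\<^esub>"
    using assms by (simp add: FactGroup_int_pow)
  also have "\<dots> \<longleftrightarrow> int (group.ord (G Mod H) (H #> x)) dvd j"
    using assms by (intro Q.int_pow_eq_id) (auto simp: carrier_FactGroup)
  finally show ?thesis .
qed

lemma DirProd_int_pow:
  assumes "group G" "group H" "x \<in> carrier G" "y \<in> carrier H"
  shows "(x, y) [^]\<^bsub>G \<times>\<times> H\<^esub> (j::int) = (x [^]\<^bsub>G\<^esub> j, y [^]\<^bsub>H\<^esub> j)"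
proof (rule prod_eqI)
  have "group (G \<times>\<times> H)"
    using assms by (simp add: DirProd_group)
  moreover have "fst \<in> hom (G \<times>\<times> H) G" "snd \<in> hom (G \<times>\<times> H) H"
    by (auto simp: hom_def)
  ultimately show "fst ((x, y) [^]\<^bsub>G \<times>\<times> H\<^esub> j) = fst (x [^]\<^bsub>G\<^esub> j, y [^]\<^bsub>H\<^esub> j)"
    "snd ((x, y) [^]\<^bsub>G \<times>\<times> H\<^esub> j) = snd (x [^]\<^bsub>G\<^esub> j, y [^]\<^bsub>H\<^esub> j)"
    using assms hom_int_pow[of fst "G \<times>\<times> H" G "(x, y)"] hom_int_pow[of snd "G \<times>\<times> H" H "(x, y)"]
    by simp_all
qed

lemma comm_group_DirProd:
  assumes "comm_group G" "comm_group H"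
  shows "comm_group (G \<times>\<times> H)"
proof -
  interpret G: comm_group G by fact
  interpret H: comm_group H by fact
  show ?thesis
    by (rule group.group_comm_groupI[OF DirProd_group[OF G.is_group H.is_group]])
       (auto simp: G.m_comm H.m_comm)
qed

lemma subset_chain_common_member:
  assumes "subset.chain \<A> \<C>" "a \<in> \<Union>\<C>" "b \<in> \<Union>\<C>"
  obtains S where "S \<in> \<C>" "a \<in> S" "b \<in> S"
proof -
  obtain S T where "S \<in> \<C>" "T \<in> \<C>" "a \<in> S" "b \<in> T"
    using assms(2,3) by blast
  moreover from this have "S \<subseteq> T \<or> T \<subseteq> S"
    using assms(1) by (auto simp: subset.chain_def)
  ultimately show thesis using that by blast
qed

lemma (in group) subgroup_Union_chain:
  assumes "subset.chain {H. subgroup H G} \<C>" "\<C> \<noteq> {}"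
  shows "subgroup (\<Union>\<C>) G"
proof (rule subgroupI)
  have sub: "subgroup H G" if "H \<in> \<C>" for H
    using assms(1) that by (auto simp: subset.chain_def)
  show "\<Union>\<C> \<subseteq> carrier G" using subgroup.subset[OF sub] by blast
  show "\<Union>\<C> \<noteq> {}" using subgroup.one_closed[OF sub] assms(2) by blast
  show "inv a \<in> \<Union>\<C>" if "a \<in> \<Union>\<C>" for a
    using that subgroup.m_inv_closed[OF sub] by blast
  show "a \<otimes> b \<in> \<Union>\<C>" if "a \<in> \<Union>\<C>" "b \<in> \<Union>\<C>" for a b
  proof -
    obtain H where "H \<in> \<C>" "a \<in> H" "b \<in> H"
      using subset_chain_common_member[OF assms(1) \<open>a \<in> \<Union>\<C>\<close> \<open>b \<in> \<Union>\<C>\<close>] .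
    then show ?thesis using subgroup.m_closed[OF sub] by blast
  qed
qed

lemma single_valued_Union_chain:
  assumes "subset.chain {R. single_valued R} \<C>"
  shows "single_valued (\<Union>\<C>)"
proof (rule single_valuedI)
  fix x y z
  assume "(x, y) \<in> \<Union>\<C>" "(x, z) \<in> \<Union>\<C>"
  then obtain R where "R \<in> \<C>" "(x, y) \<in> R" "(x, z) \<in> R"
    by (rule subset_chain_common_member[OF assms])
  then show "y = z"
    using assms by (auto simp: subset.chain_def dest: single_valuedD)
qed

text \<open>A homomorphism from a subgroup of \<open>G\<close> to \<open>D\<close> is represented by its graph.\<close>

definition partial_hom ::
    "('a, 'c) monoid_scheme \<Rightarrow> ('b, 'd) monoid_scheme \<Rightarrow> ('a \<times> 'b) set \<Rightarrow> bool"
  where "partial_hom G D R \<longleftrightarrow> subgroup R (G \<times>\<times> D) \<and> single_valued R"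

definition nontrivially_divisible :: "('a, 'b) monoid_scheme \<Rightarrow> bool"
  where "nontrivially_divisible D \<longleftrightarrow>
    (\<forall>v \<in> carrier D. \<forall>m::nat. m \<ge> 2 \<longrightarrow> (\<exists>w \<in> carrier D. w [^]\<^bsub>D\<^esub> m = v \<and> w \<noteq> \<one>\<^bsub>D\<^esub>))"

lemma (in group) nontrivially_divisible_obtain_root:
  fixes m :: nat
  assumes G: "nontrivially_divisible G" and v: "v \<in> carrier G" and "m \<noteq> 1" "m = 0 \<Longrightarrow> v = \<one>"
  obtains w where "w \<in> carrier G" "w [^] m = v" "w \<noteq> \<one>"
proof (cases "m = 0")
  case True
  moreover obtain w where "w \<in> carrier G" "w \<noteq> \<one>"
    using G one_closed unfolding nontrivially_divisible_def by blast
  ultimately show thesis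
    using that assms(4) by simp
next
  case False
  with \<open>m \<noteq> 1\<close> have "m \<ge> 2" by simp
  with that v G show thesis
    unfolding nontrivially_divisible_def by blast
qed

locale comm_group_pair = G: comm_group G + D: comm_group D
  for G :: "('a, 'c) monoid_scheme" and D :: "('b, 'd) monoid_scheme"
begin

sublocale GD: comm_group "G \<times>\<times> D"
  by (intro comm_group_DirProd G.comm_group_axioms D.comm_group_axioms)

lemma subgroup_Domain:
  assumes "subgroup R (G \<times>\<times> D)"
  shows "subgroup (Domain R) G"
proof -
  have "group_hom (G \<times>\<times> D) G fst"
    by unfold_locales (auto simp: hom_def)
  then show ?thesis
    using group_hom.subgroup_img_is_subgroup[OF _ assms] by (simp add: Domain_fst)
qed

lemma single_valued_if_fiber_one_trivial:
  assumes R: "subgroup R (G \<times>\<times> D)" and fiber: "\<And>z. (\<one>\<^bsub>G\<^esub>, z) \<in> R \<Longrightarrow> z = \<one>\<^bsub>D\<^esub>"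
  shows "single_valued R"
proof (rule single_valuedI)
  fix x y z
  assume xy: "(x, y) \<in> R" and xz: "(x, z) \<in> R"
  then have carrier: "x \<in> carrier G" "y \<in> carrier D" "z \<in> carrier D"
    using subgroup.mem_carrier[OF R] by auto
  have "(x, y) \<otimes>\<^bsub>G \<times>\<times> D\<^esub> inv\<^bsub>G \<times>\<times> D\<^esub> (x, z) \<in> R"
    using R xy xz by (simp add: subgroup.m_closed subgroup.m_inv_closed)
  then have "y \<otimes>\<^bsub>D\<^esub> inv\<^bsub>D\<^esub> z = \<one>\<^bsub>D\<^esub>"
    using carrier by (intro fiber) simp
  then show "y = z"
    using carrier D.inv_solve_right'[of "\<one>\<^bsub>D\<^esub>" y z] by simp
qed

lemma partial_hom_adjoin:
  assumes R: "partial_hom G D R" and xw_carrier: "x \<in> carrier G" "w \<in> carrier D"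
    and compatible: "\<And>j::int. x [^]\<^bsub>G\<^esub> j \<in> Domain R \<Longrightarrow> (x [^]\<^bsub>G\<^esub> j, w [^]\<^bsub>D\<^esub> j) \<in> R"
  obtains S where "partial_hom G D S" "R \<subseteq> S" "(x, w) \<in> S"
proof
  let ?W = "generate (G \<times>\<times> D) {(x, w)}"
  have R_subgroup: "subgroup R (G \<times>\<times> D)" and R_single_valued: "single_valued R"
    using R by (auto simp: partial_hom_def)
  have "subgroup ?W (G \<times>\<times> D)"
    using xw_carrier by (intro GD.generate_is_subgroup) auto
  then interpret second_isomorphism_grp R "G \<times>\<times> D" ?W
    using GD.subgroup_imp_normal[OF R_subgroup]
    by (simp add: second_isomorphism_grp_def second_isomorphism_grp_axioms_def)
  show "R \<subseteq> R <#>\<^bsub>G \<times>\<times> D\<^esub> ?W"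
    by (rule H_contained_in_set_mult)
  show "(x, w) \<in> R <#>\<^bsub>G \<times>\<times> D\<^esub> ?W"
    using S_contained_in_set_mult generate.incl[of "(x, w)" "{(x, w)}"] by blast
  have "z = \<one>\<^bsub>D\<^esub>" if z: "(\<one>\<^bsub>G\<^esub>, z) \<in> R <#>\<^bsub>G \<times>\<times> D\<^esub> ?W" for z
  proof -
    obtain a c and j :: int where ac_mem: "(a, c) \<in> R"
      and one_z_eq: "(\<one>\<^bsub>G\<^esub>, z) = (a, c) \<otimes>\<^bsub>G \<times>\<times> D\<^esub> (x [^]\<^bsub>G\<^esub> j, w [^]\<^bsub>D\<^esub> j)"
      using z xw_carrier by (auto simp: set_mult_def GD.generate_pow DirProd_int_pow)
    have a_carrier: "a \<in> carrier G"
      using mem_carrier[OF ac_mem] by simp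
    have "x [^]\<^bsub>G\<^esub> j = inv\<^bsub>G\<^esub> a"
      using one_z_eq a_carrier xw_carrier
      by (intro G.inv_equality[symmetric]) (simp_all add: G.m_comm)
    also have "\<dots> \<in> Domain R"
      using ac_mem subgroup.m_inv_closed[OF subgroup_Domain[OF R_subgroup]] by blast
    finally have "(x [^]\<^bsub>G\<^esub> j, w [^]\<^bsub>D\<^esub> j) \<in> R"
      by (rule compatible)
    with ac_mem have "(\<one>\<^bsub>G\<^esub>, z) \<in> R"
      unfolding one_z_eq by (rule m_closed)
    then show ?thesis
      using R_single_valued one_closed by (auto dest: single_valuedD)
  qed
  then show "partial_hom G D (R <#>\<^bsub>G \<times>\<times> D\<^esub> ?W)"
    unfolding partial_hom_def
    using normal_set_mult_subgroup by (blast intro: single_valued_if_fiber_one_trivial)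
qed

lemma partial_hom_extend_nontrivially:
  assumes D: "nontrivially_divisible D" and R: "partial_hom G D R"
    and x: "x \<in> carrier G" "x \<notin> Domain R"
  obtains S w where "partial_hom G D S" "R \<subseteq> S" "(x, w) \<in> S" "w \<noteq> \<one>\<^bsub>D\<^esub>"
proof -
  have R_subgroup: "subgroup R (G \<times>\<times> D)" and R_single_valued: "single_valued R"
    using R by (auto simp: partial_hom_def)
  interpret Dom: normal "Domain R" G
    by (intro G.subgroup_imp_normal subgroup_Domain R_subgroup)
  \<comment> \<open>\<open>ord\<close> is \<open>0\<close> on elements of infinite order, so \<open>m = 0\<close> is possible.\<close>
  define m where "m = group.ord (G Mod Domain R) (Domain R #>\<^bsub>G\<^esub> x)"
  have Domain_iff: "x [^]\<^bsub>G\<^esub> j \<in> Domain R \<longleftrightarrow> int m dvd j" for j :: int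
    unfolding m_def by (rule Dom.int_pow_mem_iff_ord_dvd[OF x(1)])
  have "m \<noteq> 1"
    using Domain_iff[of 1] x by auto
  obtain v where v: "(x [^]\<^bsub>G\<^esub> int m, v) \<in> R"
    using Domain_iff[of "int m"] by auto
  then have "v \<in> carrier D"
    using subgroup.mem_carrier[OF R_subgroup] by auto
  moreover have "v = \<one>\<^bsub>D\<^esub>" if "m = 0"
    using that v R_single_valued subgroup.one_closed[OF R_subgroup] by (auto dest: single_valuedD)
  ultimately obtain w where w: "w \<in> carrier D" "w [^]\<^bsub>D\<^esub> m = v" "w \<noteq> \<one>\<^bsub>D\<^esub>"
    using D \<open>m \<noteq> 1\<close> D.nontrivially_divisible_obtain_root by blast
  have "(x [^]\<^bsub>G\<^esub> j, w [^]\<^bsub>D\<^esub> j) \<in> R" if "x [^]\<^bsub>G\<^esub> j \<in> Domain R" for j :: int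
  proof -
    obtain q where q: "j = int m * q"
      using \<open>x [^]\<^bsub>G\<^esub> j \<in> Domain R\<close> by (auto simp: Domain_iff)
    have "(x [^]\<^bsub>G\<^esub> int m, w [^]\<^bsub>D\<^esub> int m) [^]\<^bsub>G \<times>\<times> D\<^esub> q \<in> R"
      using v w(2) by (intro GD.subgroup_int_pow_closed[OF R_subgroup]) (simp add: int_pow_int)
    then show ?thesis
      using x(1) w(1) by (simp add: q DirProd_int_pow G.int_pow_pow D.int_pow_pow)
  qed
  with R x(1) w(1) obtain S where "partial_hom G D S" "R \<subseteq> S" "(x, w) \<in> S"
    by (rule partial_hom_adjoin)
  with that w(3) show thesis by blast
qed

lemma partial_hom_Union_chain:
  assumes "subset.chain {R. partial_hom G D R} \<C>" "\<C> \<noteq> {}"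
  shows "partial_hom G D (\<Union>\<C>)"
  unfolding partial_hom_def
proof
  show "subgroup (\<Union>\<C>) (G \<times>\<times> D)"
    using assms by (intro GD.subgroup_Union_chain) (auto simp: subset.chain_def partial_hom_def)
  show "single_valued (\<Union>\<C>)"
    using assms by (intro single_valued_Union_chain) (auto simp: subset.chain_def partial_hom_def)
qed

lemma partial_hom_total_extension:
  assumes D: "nontrivially_divisible D" and R: "partial_hom G D R"
  obtains M where "partial_hom G D M" "R \<subseteq> M" "Domain M = carrier G"
proof -
  let ?E = "{S. partial_hom G D S \<and> R \<subseteq> S}"
  have "\<exists>M\<in>?E. \<forall>S\<in>?E. M \<subseteq> S \<longrightarrow> S = M"
  proof (rule subset_Zorn_nonempty)
    show "?E \<noteq> {}" using R by blast
    fix \<C> assume ne: "\<C> \<noteq> {}" and chain: "subset.chain ?E \<C>"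
    then have "partial_hom G D (\<Union>\<C>)"
      by (intro partial_hom_Union_chain) (auto simp: subset.chain_def)
    moreover have "R \<subseteq> \<Union>\<C>" using ne chain by (fastforce simp: subset.chain_def)
    ultimately show "\<Union>\<C> \<in> ?E" by blast
  qed
  then obtain M where M: "partial_hom G D M" "R \<subseteq> M"
    and maximal: "\<And>S. partial_hom G D S \<Longrightarrow> M \<subseteq> S \<Longrightarrow> S = M" by auto
  have "x \<in> Domain M" if "x \<in> carrier G" for x
  proof (rule ccontr)
    assume "x \<notin> Domain M"
    with D M(1) that obtain S w where "partial_hom G D S" "M \<subseteq> S" "(x, w) \<in> S"
      by (rule partial_hom_extend_nontrivially)
    with maximal \<open>x \<notin> Domain M\<close> show False by blast
  qed
  moreover have "Domain M \<subseteq> carrier G"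
    using M(1) by (intro subgroup.subset subgroup_Domain) (simp add: partial_hom_def)
  ultimately show ?thesis using that M by blast
qed

lemma partial_hom_total_imp_hom:
  assumes M: "partial_hom G D M" and total: "Domain M = carrier G"
  obtains h where "h \<in> hom G D" "\<And>x z. (x, z) \<in> M \<Longrightarrow> h x = z"
proof
  interpret M: subgroup M "G \<times>\<times> D"
    using M by (simp add: partial_hom_def)
  let ?h = "\<lambda>x. THE z. (x, z) \<in> M"
  show h_eq: "?h x = z" if "(x, z) \<in> M" for x z
    using that M unfolding partial_hom_def by (blast dest: single_valuedD)
  have graph: "(x, ?h x) \<in> M" if "x \<in> carrier G" for x
    using that total h_eq by force
  show "?h \<in> hom G D"
  proof (rule homI)
    show "?h x \<in> carrier D" if "x \<in> carrier G" for x
      using M.mem_carrier[OF graph[OF that]] by simp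
    show "?h (x \<otimes>\<^bsub>G\<^esub> y) = ?h x \<otimes>\<^bsub>D\<^esub> ?h y" if "x \<in> carrier G" "y \<in> carrier G" for x y
      using M.m_closed[OF graph[OF that(1)] graph[OF that(2)]] by (intro h_eq) simp
  qed
qed

lemma hom_separating_point_from_subgroup:
  assumes D: "nontrivially_divisible D" and K: "subgroup K G" and b: "b \<in> carrier G" "b \<notin> K"
  obtains h where "h \<in> hom G D" "\<And>x. x \<in> K \<Longrightarrow> h x = \<one>\<^bsub>D\<^esub>" "h b \<noteq> \<one>\<^bsub>D\<^esub>"
proof -
  have "partial_hom G D (K \<times> {\<one>\<^bsub>D\<^esub>})"
    using DirProd_subgroups[OF G.is_group K D.is_group D.triv_subgroup]
    by (auto simp: partial_hom_def single_valued_def)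
  moreover have "b \<notin> Domain (K \<times> {\<one>\<^bsub>D\<^esub>})" using b(2) by blast
  ultimately obtain R w where R: "partial_hom G D R" "K \<times> {\<one>\<^bsub>D\<^esub>} \<subseteq> R" "(b, w) \<in> R" "w \<noteq> \<one>\<^bsub>D\<^esub>"
    using D b(1) partial_hom_extend_nontrivially by blast
  obtain M where M: "partial_hom G D M" "R \<subseteq> M" "Domain M = carrier G"
    using partial_hom_total_extension[OF D R(1)] by blast
  obtain h where "h \<in> hom G D" "\<And>x z. (x, z) \<in> M \<Longrightarrow> h x = z"
    using partial_hom_total_imp_hom[OF M(1,3)] by blast
  with that M(2) R show thesis by blast
qed

end

section \<open>The circle group\<close>

definition circle_group :: "complex monoid"
  where "circle_group = \<lparr>carrier = sphere 0 1, monoid.mult = (*), one = 1\<rparr>"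

lemma circle_group_simps [simp]:
  "carrier circle_group = sphere 0 1"
  "x \<otimes>\<^bsub>circle_group\<^esub> y = x * y"
  "\<one>\<^bsub>circle_group\<^esub> = 1"
  by (simp_all add: circle_group_def)

lemma comm_group_circle_group: "comm_group circle_group"
proof (rule comm_groupI)
  fix x assume "x \<in> carrier circle_group"
  then have "cmod x = 1" by simp
  then have "inverse x \<in> carrier circle_group" "inverse x * x = 1"
    by (auto simp: norm_inverse intro!: left_inverse)
  then show "\<exists>y\<in>carrier circle_group. y \<otimes>\<^bsub>circle_group\<^esub> x = \<one>\<^bsub>circle_group\<^esub>"
    by auto
qed (auto simp: norm_mult)

lemma circle_group_pow [simp]: "z [^]\<^bsub>circle_group\<^esub> (n::nat) = z ^ n"
  by (induction n) (simp_all add: nat_pow_def)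

lemma finprod_circle_group:
  assumes "f \<in> I \<rightarrow> carrier circle_group"
  shows "finprod circle_group f I = prod f I"
proof -
  interpret comm_group circle_group by (rule comm_group_circle_group)
  show ?thesis
    using assms by (induction I rule: infinite_finite_induct) (auto simp del: circle_group_simps(1))
qed

lemma nontrivially_divisible_circle_group: "nontrivially_divisible circle_group"
  unfolding nontrivially_divisible_def
proof (intro ballI allI impI)
  fix v :: complex and m :: nat
  assume v: "v \<in> carrier circle_group" and m: "m \<ge> 2"
  then have "card {z. z ^ m = v} = m"
    by (intro card_nth_roots) auto
  then have "\<not> {z. z ^ m = v} \<subseteq> {1}"
    using m card_mono[of "{1::complex}" "{z. z ^ m = v}"] by auto
  then obtain w where w: "w ^ m = v" "w \<noteq> 1" by blast
  then have "cmod w ^ m = 1 ^ m"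
    using v by (auto simp flip: norm_power)
  then have "cmod w = 1"
    using m power_eq_imp_eq_base[of "cmod w" m 1] by simp
  with w show "\<exists>w\<in>carrier circle_group. w [^]\<^bsub>circle_group\<^esub> m = v \<and> w \<noteq> \<one>\<^bsub>circle_group\<^esub>"
    by auto
qed

section \<open>Homomorphisms on products of groups\<close>

lemma comm_group_product_group:
  assumes "\<And>i. i \<in> I \<Longrightarrow> comm_group (G i)"
  shows "comm_group (product_group I G)"
proof (rule group.group_comm_groupI)
  show "group (product_group I G)"
    using assms by (simp add: comm_group.axioms(2))
  show "x \<otimes>\<^bsub>product_group I G\<^esub> y = y \<otimes>\<^bsub>product_group I G\<^esub> x"
    if "x \<in> carrier (product_group I G)" "y \<in> carrier (product_group I G)" for x y
    unfolding mult_product_group using that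
    by (intro restrict_ext comm_monoid.m_comm comm_group.axioms(1) assms) (auto simp: PiE_iff)
qed

lemma hom_constant_tuple: "(\<lambda>y. \<lambda>i\<in>I. y) \<in> hom G (product_group I (\<lambda>_. G))"
  by (rule homI) auto

lemma subgroup_hom_image_constant_tuples:
  assumes "group G" "group H" and A: "A \<in> hom (product_group I (\<lambda>_. G)) H"
  shows "subgroup ((\<lambda>y. A (\<lambda>i\<in>I. y)) ` carrier G) H"
proof -
  have "A \<circ> (\<lambda>y. \<lambda>i\<in>I. y) \<in> hom G H"
    by (rule Group.hom_compose[OF hom_constant_tuple A])
  with assms have "group_hom G H (A \<circ> (\<lambda>y. \<lambda>i\<in>I. y))"
    by (simp add: group_hom_def group_hom_axioms_def)
  from group_hom.img_is_subgroup[OF this] show ?thesis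
    by (simp add: comp_def)
qed

definition single_coordinate :: "'i set \<Rightarrow> ('i \<Rightarrow> ('a, 'b) monoid_scheme) \<Rightarrow> 'i \<Rightarrow> 'a \<Rightarrow> 'i \<Rightarrow> 'a"
  where "single_coordinate I G i g = (\<lambda>j\<in>I. if j = i then g else \<one>\<^bsub>G j\<^esub>)"

lemma single_coordinate_closed:
  assumes "\<And>i. i \<in> I \<Longrightarrow> group (G i)" "g \<in> carrier (G i)"
  shows "single_coordinate I G i g \<in> carrier (product_group I G)"
  using assms by (auto simp: single_coordinate_def group.is_monoid)

lemma hom_product_group_eq_finprod:
  assumes "finite I" and G: "\<And>i. i \<in> I \<Longrightarrow> group (G i)" and "comm_group H"
    and F: "F \<in> hom (product_group I G) H" and x: "x \<in> carrier (product_group I G)"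
  shows "F x = (\<Otimes>\<^bsub>H\<^esub>i\<in>I. F (single_coordinate I G i (x i)))"
proof -
  interpret H: comm_group H by fact
  let ?x = "\<lambda>J. \<lambda>i\<in>I. if i \<in> J then x i else \<one>\<^bsub>G i\<^esub>"
  have single: "single_coordinate I G i (x i) \<in> carrier (product_group I G)" if "i \<in> I" for i
    using x that by (intro single_coordinate_closed G) auto
  have "F (?x J) = (\<Otimes>\<^bsub>H\<^esub>i\<in>J. F (single_coordinate I G i (x i)))" if "finite J" "J \<subseteq> I" for J
    using that
  proof (induction J rule: finite_induct)
    case empty
    show ?case
      using hom_one[OF F product_group[OF G] H.is_group] by (simp add: restrict_def)
  next
    case (insert i J)
    then have "i \<in> I" "J \<subseteq> I" by auto
    have insert_eq: "?x (insert i J) = single_coordinate I G i (x i) \<otimes>\<^bsub>product_group I G\<^esub> ?x J"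
      using insert.hyps \<open>i \<in> I\<close> x G
      by (auto simp: single_coordinate_def fun_eq_iff group.is_monoid PiE_iff)
    have "?x J \<in> carrier (product_group I G)"
      using x G by (auto simp: group.is_monoid)
    then have "F (?x (insert i J)) = F (single_coordinate I G i (x i)) \<otimes>\<^bsub>H\<^esub> F (?x J)"
      unfolding insert_eq by (rule hom_mult[OF F single[OF \<open>i \<in> I\<close>]])
    also have "\<dots> = (\<Otimes>\<^bsub>H\<^esub>l\<in>insert i J. F (single_coordinate I G l (x l)))"
      unfolding insert.IH[OF \<open>J \<subseteq> I\<close>]
      using insert.hyps \<open>i \<in> I\<close> \<open>J \<subseteq> I\<close> single hom_in_carrier[OF F]
      by (intro H.finprod_insert[symmetric]) blast+
    finally show ?case .
  qed
  moreover have "?x I = x"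
    using x by (auto simp: fun_eq_iff PiE_def extensional_def)
  ultimately show ?thesis
    using \<open>finite I\<close> by (metis subset_refl)
qed

lemma dist_hom_circle_group_le_sum:
  assumes "finite I" and G: "\<And>i. i \<in> I \<Longrightarrow> group (G i)"
    and F: "F \<in> hom (product_group I G) circle_group"
    and x: "x \<in> carrier (product_group I G)" and y: "y \<in> carrier (product_group I G)"
  shows "dist (F x) (F y) \<le>
    (\<Sum>i\<in>I. dist (F (single_coordinate I G i (x i))) (F (single_coordinate I G i (y i))))"
proof -
  have circle: "F (single_coordinate I G i (z i)) \<in> carrier circle_group"
    if "z \<in> carrier (product_group I G)" "i \<in> I" for z i
    using that by (intro hom_in_carrier[OF F] single_coordinate_closed G) auto
  have "F z = (\<Prod>i\<in>I. F (single_coordinate I G i (z i)))"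
    if "z \<in> carrier (product_group I G)" for z
    using hom_product_group_eq_finprod[OF \<open>finite I\<close> G comm_group_circle_group F that] circle that
    by (subst finprod_circle_group[symmetric]) auto
  with x y circle show ?thesis
    unfolding dist_norm by (auto intro!: norm_prod_diff)
qed

section \<open>Finite colourings\<close>

lemma partition_on_fibers: "partition_on S ((\<lambda>v. {x \<in> S. c x = v}) ` c ` S)"
  by (rule partition_onI) (auto simp: disjnt_def)

lemma finite_partition_small_oscillation:
  fixes f :: "'i \<Rightarrow> 'a \<Rightarrow> 'b::metric_space"
  assumes "finite I" "\<And>i. i \<in> I \<Longrightarrow> totally_bounded (f i ` S)" "\<epsilon> > 0"
  obtains P where "partition_on S P" "finite P"
    "\<forall>C\<in>P. \<forall>i\<in>I. \<forall>x\<in>C. \<forall>y\<in>C. dist (f i x) (f i y) < \<epsilon>"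
proof -
  have "\<exists>N. finite N \<and> f i ` S \<subseteq> (\<Union>p\<in>N. ball p (\<epsilon> / 2))" if "i \<in> I" for i
    using assms(2)[OF that] half_gt_zero[OF \<open>\<epsilon> > 0\<close>]
    unfolding totally_bounded_metric ball_def by blast
  then obtain N where N: "\<And>i. i \<in> I \<Longrightarrow> finite (N i)"
    "\<And>i. i \<in> I \<Longrightarrow> f i ` S \<subseteq> (\<Union>p\<in>N i. ball p (\<epsilon> / 2))"
    by metis
  define colour where "colour x = {(i, p) \<in> Sigma I N. f i x \<in> ball p (\<epsilon> / 2)}" for x
  define P where "P = (\<lambda>v. {x \<in> S. colour x = v}) ` colour ` S"
  show thesis
  proof
    show "partition_on S P"
      unfolding P_def by (rule partition_on_fibers)
    have "colour ` S \<subseteq> Pow (Sigma I N)" by (auto simp: colour_def)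
    then show "finite P"
      unfolding P_def using assms(1) N(1)
      by (meson finite_Pow_iff finite_SigmaI finite_imageI finite_subset)
    show "\<forall>C\<in>P. \<forall>i\<in>I. \<forall>x\<in>C. \<forall>y\<in>C. dist (f i x) (f i y) < \<epsilon>"
    proof (intro ballI)
      fix C i x y
      assume "C \<in> P" and i: "i \<in> I" and "x \<in> C" "y \<in> C"
      then have x: "x \<in> S" and same_colour: "colour x = colour y" by (auto simp: P_def)
      obtain p where "(i, p) \<in> colour x"
        using N(2)[OF i] x i by (fastforce simp: colour_def)
      with same_colour have "dist p (f i x) < \<epsilon> / 2" "dist p (f i y) < \<epsilon> / 2"
        by (auto simp: colour_def)
      then show "dist (f i x) (f i y) < \<epsilon>"
        by (rule dist_triangle_half_r)
    qed
  qed
qed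

lemma finite_partition_hom_circle_group_small_oscillation:
  assumes "finite I" "group G"
    and F: "F \<in> hom (product_group I (\<lambda>_. G)) circle_group" and "\<epsilon> > 0"
  obtains P where "partition_on (carrier G) P" "finite P"
    "\<forall>C\<in>P. \<forall>x \<in> I \<rightarrow>\<^sub>E C. \<forall>y \<in> I \<rightarrow>\<^sub>E C. dist (F x) (F y) < \<epsilon>"
proof -
  define f where "f i g = F (single_coordinate I (\<lambda>_. G) i g)" for i g
  define \<delta> where "\<delta> = \<epsilon> / (card I + 1)"
  have "\<delta> > 0" using \<open>\<epsilon> > 0\<close> by (simp add: \<delta>_def)
  have "totally_bounded (sphere (0::complex) 1)"
    using compact_sphere[of "0::complex" 1]
    by (simp add: compact_eq_totally_bounded totally_bounded_metric ball_def)
  moreover have "f i ` carrier G \<subseteq> sphere 0 1" for i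
    using hom_in_carrier[OF F single_coordinate_closed] \<open>group G\<close> by (auto simp: f_def)
  ultimately have "totally_bounded (f i ` carrier G)" for i
    by (rule totally_bounded_subset)
  with \<open>finite I\<close> obtain P where P: "partition_on (carrier G) P" "finite P"
    and close: "\<forall>C\<in>P. \<forall>i\<in>I. \<forall>g\<in>C. \<forall>h\<in>C. dist (f i g) (f i h) < \<delta>"
    using \<open>\<delta> > 0\<close> by (rule finite_partition_small_oscillation)
  have "dist (F x) (F y) < \<epsilon>" if C: "C \<in> P" and x: "x \<in> I \<rightarrow>\<^sub>E C" and y: "y \<in> I \<rightarrow>\<^sub>E C" for C x y
  proof -
    have "C \<subseteq> carrier G" using C P(1) by (auto simp: partition_on_def)
    then have "dist (F x) (F y) \<le> (\<Sum>i\<in>I. dist (f i (x i)) (f i (y i)))"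
      unfolding f_def using x y \<open>group G\<close>
      by (intro dist_hom_circle_group_le_sum[OF \<open>finite I\<close> _ F]) auto
    also have "\<dots> \<le> card I * \<delta>"
      using close C x y by (intro sum_bounded_above less_imp_le) (auto simp: PiE_iff)
    also have "\<dots> < (card I + 1) * \<delta>"
      using \<open>\<delta> > 0\<close> by simp
    also have "\<dots> = \<epsilon>" by (simp add: \<delta>_def)
    finally show ?thesis .
  qed
  with that P show thesis by blast
qed

lemma finite_partition_without_monochromatic_solution:
  assumes "finite I" "group G" "comm_group H"
    and A: "A \<in> hom (product_group I (\<lambda>_. G)) H" and b: "b \<in> carrier H"
    and no_constant: "\<And>y. y \<in> carrier G \<Longrightarrow> A (\<lambda>i\<in>I. y) \<noteq> b"
  obtains P where "partition_on (carrier G) P" "finite P"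
    "\<forall>C\<in>P. \<forall>x \<in> I \<rightarrow>\<^sub>E C. A x \<noteq> b"
proof -
  interpret comm_group_pair H circle_group
    by (intro comm_group_pair.intro \<open>comm_group H\<close> comm_group_circle_group)
  let ?K = "(\<lambda>y. A (\<lambda>i\<in>I. y)) ` carrier G"
  have "subgroup ?K H"
    using \<open>group G\<close> comm_group.axioms(2)[OF \<open>comm_group H\<close>] A
    by (rule subgroup_hom_image_constant_tuples)
  moreover have "b \<notin> ?K" using no_constant by auto
  ultimately obtain \<psi> where \<psi>: "\<psi> \<in> hom H circle_group"
    "\<And>z. z \<in> ?K \<Longrightarrow> \<psi> z = \<one>\<^bsub>circle_group\<^esub>" "\<psi> b \<noteq> \<one>\<^bsub>circle_group\<^esub>"
    using hom_separating_point_from_subgroup[OF nontrivially_divisible_circle_group _ b] by metis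
  have "\<psi> \<circ> A \<in> hom (product_group I (\<lambda>_. G)) circle_group"
    by (rule Group.hom_compose[OF A \<psi>(1)])
  moreover have "dist (\<psi> b) 1 > 0" using \<psi>(3) by simp
  ultimately obtain P where P: "partition_on (carrier G) P" "finite P"
    and close: "\<forall>C\<in>P. \<forall>x \<in> I \<rightarrow>\<^sub>E C. \<forall>y \<in> I \<rightarrow>\<^sub>E C.
      dist ((\<psi> \<circ> A) x) ((\<psi> \<circ> A) y) < dist (\<psi> b) 1"
    by (rule finite_partition_hom_circle_group_small_oscillation[OF \<open>finite I\<close> \<open>group G\<close>])
  have "A x \<noteq> b" if C: "C \<in> P" and x: "x \<in> I \<rightarrow>\<^sub>E C" for C x
  proof
    assume "A x = b"
    have "C \<noteq> {}" "C \<subseteq> carrier G"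
      using C partition_onD1[OF P(1)] partition_onD3[OF P(1)] by auto
    then obtain y where y: "y \<in> C" "y \<in> carrier G" by blast
    then have "\<psi> (A (\<lambda>i\<in>I. y)) = 1" using \<psi>(2) by simp
    moreover have "(\<lambda>i\<in>I. y) \<in> I \<rightarrow>\<^sub>E C" using y(1) by simp
    then have "dist ((\<psi> \<circ> A) x) ((\<psi> \<circ> A) (\<lambda>i\<in>I. y)) < dist (\<psi> b) 1"
      using close C x by blast
    ultimately show False using \<open>A x = b\<close> by simp
  qed
  with that P show thesis by blast
qed

lemma partition_regular_if_constant_solution:
  assumes "y \<in> carrier G" "A (\<lambda>i\<in>{..<n}. y) = b"
  shows "partition_regular G n A b"
  unfolding partition_regular_def
proof (intro allI impI)
  fix P assume "partition_on (carrier G) P \<and> finite P"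
  then obtain C where "C \<in> P" "y \<in> C"
    using assms(1) by (auto simp: partition_on_def)
  with assms show "\<exists>x \<in> carrier (power_group G n). A x = b \<and> (\<exists>C\<in>P. \<forall>i<n. x i \<in> C)"
    by (intro bexI[of _ "\<lambda>i\<in>{..<n}. y"]) auto
qed

lemma constant_solution_if_partition_regular:
  assumes "group G" "comm_group H" "A \<in> hom (power_group G n) H" "b \<in> carrier H"
    and regular: "partition_regular G n A b"
  shows "\<exists>y \<in> carrier G. A (\<lambda>i\<in>{..<n}. y) = b"
proof (rule ccontr)
  assume "\<not> (\<exists>y \<in> carrier G. A (\<lambda>i\<in>{..<n}. y) = b)"
  then obtain P where P: "partition_on (carrier G) P" "finite P"
    and no_solution: "\<forall>C\<in>P. \<forall>x \<in> {..<n} \<rightarrow>\<^sub>E C. A x \<noteq> b"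
    using finite_partition_without_monochromatic_solution[OF finite_lessThan assms(1-4)] by metis
  from regular P obtain x C where x: "x \<in> carrier (power_group G n)" "A x = b"
    and C: "C \<in> P" "\<forall>i<n. x i \<in> C"
    unfolding partition_regular_def by blast
  then have "x \<in> {..<n} \<rightarrow>\<^sub>E C" by (simp add: PiE_iff)
  with no_solution C(1) x(2) show False by blast
qed

theorem theorem4p2:
  fixes G :: "('a, 'b) monoid_scheme" and k n :: nat
    and A :: "(nat \<Rightarrow> 'a) \<Rightarrow> (nat \<Rightarrow> 'a)" and b :: "nat \<Rightarrow> 'a"
  assumes "comm_group G"
    and "A \<in> hom (power_group G n) (power_group G k)"
    and "b \<in> carrier (power_group G k)"
    and "b \<noteq> \<one>\<^bsub>power_group G k\<^esub>"
  shows "partition_regular G n A b \<longleftrightarrow>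
    (\<exists>y \<in> carrier G. A (\<lambda>i\<in>{..<n}. y) = b)"
proof
  have "group G" "comm_group (power_group G k)"
    using assms(1) by (simp_all add: comm_group.axioms(2) comm_group_product_group)
  then show "\<exists>y \<in> carrier G. A (\<lambda>i\<in>{..<n}. y) = b" if "partition_regular G n A b"
    using assms(2,3) that by (rule constant_solution_if_partition_regular)
  show "partition_regular G n A b" if "\<exists>y \<in> carrier G. A (\<lambda>i\<in>{..<n}. y) = b"
    using that by (blast intro: partition_regular_if_constant_solution)
qed

end
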